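(* Let $K$ be a non-trivial (additively) idempotent semiring. Then $a\mapsto\overline a^1$ and $a\mapsto\overline a^0$ are both faithful involutive category representations of $\mathcal B_{\mathrm{odd}}$ in $\mathcal M(K)$ (given on objects by $n\mapsto2^{n-1}$). These both yield faithful involutive representations of the monoids $\mathcal B_n$, for each odd $n$, by $2^{n-1}\times2^{n-1}$ matrices over $K$.
   Context: **Brauer category.** $\mathbb N=\{0,1,2,\ldots\}$, $[n]=\{1,\ldots,n\}$. For $A\subseteq\mathbb N$, $A'$ and $A''$ are disjoint copies of $A$. $\mathcal B_{m,n}$ is the set of all set partitions of $[m]\cup[n]'$ in which every block has size $2$ (empty unless $m\equiv n\bmod 2$). The elements of $a$ are called $a$-blocks, and $a$ is identified with the graph whose connected components are its blocks. For $a\in\mathcal B_{m,n}$, $b\in\mathcal B_{n,t}$, the product graph $\Pi(a,b)$ has vertex set $[m]\cup[n]''\cup[t]'$ and edges those of $a$ (lower vertices $x'$ renamed $x''$) and of $b$ (upper vertices $x$ renamed $x''$); $ab\in\mathcal B_{m,t}$ is the partition in which $x,y\in[m]\cup[t]'$ are in the same block iff they are in the same component of $\Pi(a,b)$. The Brauer category $\mathcal B$ has objects $\mathbb N$, hom-sets $\mathcal B_{m,n}$, this composition, identities $\iota_n=\{\{i,i'\}:i\in[n]\}$, and involution $a\mapsto a^*$ swapping $i\leftrightarrow i'$. $\mathcal B_n=\mathcal B_{n,n}$ is the Brauer monoid. $\mathcal B_{\mathrm{odd}}$ is the full subcategory of $\mathcal B$ on the odd natural numbers, i.e. $\bigcup_{m,n\text{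 odd}}\mathcal B_{m,n}$. **Matrices.** A semiring $(K,+,\cdot,0,1)$ has $(K,+,0)$ a commutative monoid, $(K,\cdot,1)$ a monoid, distributivity, and $0$ a multiplicative zero; non-trivial means $0\ne1$; idempotent means $1+1=1$. $\mathcal M(K)$ is the category with object set $\mathbb N$, hom-sets the $m\times n$ matrices over $K$, composition matrix multiplication, involution transpose. For $a\in\mathcal B_{m,n}$, $\overline a$ is the $2^m\times2^n$ matrix over $K$, rows and columns indexed by subsets of $[m]$ and $[n]$, with $\overline a_{X,Y}=1$ if $X\cup Y'$ is a (possibly empty) union of $a$-blocks, and $0$ otherwise. $\overline a^1$ (resp. $\overline a^0$) is the submatrix of $\overline a$ on the rows and columns indexed by subsets of odd (resp. even) cardinality; for $m,n\ge1$ these are $2^{m-1}\times2^{n-1}$ matrices. **Representations.** A category representation is a functor; it is faithful if injective on objects and on morphisms, and involutive if it preserves the involutions. *)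

theory Defs
  imports
    "HOL-Library.Disjoint_Sets"
    "HOL-Algebra.Group"
    "Jordan_Normal_Form.Matrix"
    "Jordan_Normal_Form.DL_Submatrix"
begin

section \<open>Categories with an involution and their representations\<close>

text \<open>Composition is written in diagrammatic order: for \<open>a\<close> in \<open>Hom C x y\<close> and \<open>b\<close> in
  \<open>Hom C y z\<close>, the composite \<open>a b\<close> in \<open>Hom C x z\<close> is \<open>Comp C x y z a b\<close>.\<close>

record ('o, 'a) inv_category =
  Ob :: "'o set"
  Hom :: "'o \<Rightarrow> 'o \<Rightarrow> 'a set"
  Ident :: "'o \<Rightarrow> 'a"
  Comp :: "'o \<Rightarrow> 'o \<Rightarrow> 'o \<Rightarrow> 'a \<Rightarrow> 'a \<Rightarrow> 'a"
  Star :: "'a \<Rightarrow> 'a"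

text \<open>The law \<open>(a b)\<^sup>* = b\<^sup>* a\<^sup>*\<close> is deliberately not required: it fails for the transpose of
  matrices over a semiring whose multiplication is not commutative.\<close>

locale inv_category =
  fixes C :: "('o, 'a) inv_category"
  assumes Ident_closed: "x \<in> Ob C \<Longrightarrow> Ident C x \<in> Hom C x x"
    and Comp_closed:
      "\<lbrakk>x \<in> Ob C; y \<in> Ob C; z \<in> Ob C; a \<in> Hom C x y; b \<in> Hom C y z\<rbrakk>
        \<Longrightarrow> Comp C x y z a b \<in> Hom C x z"
    and Comp_Ident_left:
      "\<lbrakk>x \<in> Ob C; y \<in> Ob C; a \<in> Hom C x y\<rbrakk> \<Longrightarrow> Comp C x x y (Ident C x) a = a"
    and Comp_Ident_right:
      "\<lbrakk>x \<in> Ob C; y \<in> Ob C; a \<in> Hom C x y\<rbrakk> \<Longrightarrow> Comp C x y y a (Ident C y) = a"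
    and Comp_assoc:
      "\<lbrakk>w \<in> Ob C; x \<in> Ob C; y \<in> Ob C; z \<in> Ob C;
        a \<in> Hom C w x; b \<in> Hom C x y; c \<in> Hom C y z\<rbrakk>
        \<Longrightarrow> Comp C w y z (Comp C w x y a b) c = Comp C w x z a (Comp C x y z b c)"
    and Star_closed: "\<lbrakk>x \<in> Ob C; y \<in> Ob C; a \<in> Hom C x y\<rbrakk> \<Longrightarrow> Star C a \<in> Hom C y x"
    and Star_Star: "\<lbrakk>x \<in> Ob C; y \<in> Ob C; a \<in> Hom C x y\<rbrakk> \<Longrightarrow> Star C (Star C a) = a"

definition full_subcategory :: "('o, 'a) inv_category \<Rightarrow> 'o set \<Rightarrow> ('o, 'a) inv_category" where
  "full_subcategory C S = C\<lparr>Ob := Ob C \<inter> S\<rparr>"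

definition arrows :: "('o, 'a) inv_category \<Rightarrow> ('o \<times> 'o \<times> 'a) set" where
  "arrows C = {(x, y, a). x \<in> Ob C \<and> y \<in> Ob C \<and> a \<in> Hom C x y}"

locale inv_functor = source: inv_category C + target: inv_category D
  for C :: "('o, 'a) inv_category" and D :: "('p, 'b) inv_category"
    and Fo :: "'o \<Rightarrow> 'p" and Fm :: "'o \<Rightarrow> 'o \<Rightarrow> 'a \<Rightarrow> 'b" +
  assumes Fo_closed: "x \<in> Ob C \<Longrightarrow> Fo x \<in> Ob D"
    and Fm_closed:
      "\<lbrakk>x \<in> Ob C; y \<in> Ob C; a \<in> Hom C x y\<rbrakk> \<Longrightarrow> Fm x y a \<in> Hom D (Fo x) (Fo y)"
    and Fm_Ident: "x \<in> Ob C \<Longrightarrow> Fm x x (Ident C x) = Ident D (Fo x)"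
    and Fm_Comp:
      "\<lbrakk>x \<in> Ob C; y \<in> Ob C; z \<in> Ob C; a \<in> Hom C x y; b \<in> Hom C y z\<rbrakk>
        \<Longrightarrow> Fm x z (Comp C x y z a b) = Comp D (Fo x) (Fo y) (Fo z) (Fm x y a) (Fm y z b)"
    and Fm_Star:
      "\<lbrakk>x \<in> Ob C; y \<in> Ob C; a \<in> Hom C x y\<rbrakk> \<Longrightarrow> Fm y x (Star C a) = Star D (Fm x y a)"

locale faithful_inv_functor = inv_functor C D Fo Fm
  for C :: "('o, 'a) inv_category" and D :: "('p, 'b) inv_category"
    and Fo :: "'o \<Rightarrow> 'p" and Fm :: "'o \<Rightarrow> 'o \<Rightarrow> 'a \<Rightarrow> 'b" +
  assumes inj_on_objects: "inj_on Fo (Ob C)"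
    and inj_on_arrows: "inj_on (\<lambda>(x, y, a). Fm x y a) (arrows C)"

definition End_monoid :: "('o, 'a) inv_category \<Rightarrow> 'o \<Rightarrow> 'a monoid" where
  "End_monoid C x =
    \<lparr>carrier = Hom C x x, monoid.mult = Comp C x x x, one = Ident C x\<rparr>"

locale faithful_inv_monoid_rep = source: monoid G + target: monoid H
  for G :: "'a monoid" and starG :: "'a \<Rightarrow> 'a"
    and H :: "'b monoid" and starH :: "'b \<Rightarrow> 'b" and f :: "'a \<Rightarrow> 'b" +
  assumes f_hom: "f \<in> hom G H"
    and f_one: "f \<one>\<^bsub>G\<^esub> = \<one>\<^bsub>H\<^esub>"
    and f_star: "a \<in> carrier G \<Longrightarrow> f (starG a) = starH (f a)"
    and f_inj: "inj_on f (carrier G)"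


section \<open>The Brauer category\<close>

text \<open>\<open>Upper i\<close>, \<open>Lower i\<close> and \<open>Middle i\<close> stand for \<open>i\<close>, \<open>i'\<close> and \<open>i''\<close>.\<close>

datatype vertex = Upper nat | Lower nat | Middle nat

definition verts :: "nat \<Rightarrow> nat \<Rightarrow> vertex set" where
  "verts m n = Upper ` {1..m} \<union> Lower ` {1..n}"

definition brauer :: "nat \<Rightarrow> nat \<Rightarrow> vertex set set set" where
  "brauer m n = {a. partition_on (verts m n) a \<and> (\<forall>B\<in>a. card B = 2)}"

fun lower_to_middle :: "vertex \<Rightarrow> vertex" where
  "lower_to_middle (Lower i) = Middle i"
| "lower_to_middle v = v"

fun upper_to_middle :: "vertex \<Rightarrow> vertex" where
  "upper_to_middle (Upper i) = Middle i"
| "upper_to_middle v = v"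

fun swap_vertex :: "vertex \<Rightarrow> vertex" where
  "swap_vertex (Upper i) = Lower i"
| "swap_vertex (Lower i) = Upper i"
| "swap_vertex (Middle i) = Middle i"

definition product_graph :: "vertex set set \<Rightarrow> vertex set set \<Rightarrow> vertex rel" where
  "product_graph a b =
    {(x, y). \<exists>B \<in> (`) lower_to_middle ` a \<union> (`) upper_to_middle ` b. x \<in> B \<and> y \<in> B}"

text \<open>The edge relation is symmetric, so its reflexive transitive closure relates exactly the
  vertices in a common component.\<close>

definition brauer_mult :: "nat \<Rightarrow> nat \<Rightarrow> nat \<Rightarrow> vertex set set \<Rightarrow> vertex set set \<Rightarrow> vertex set set"
  where "brauer_mult m n t a b =
    verts m t // {(x, y). x \<in> verts m t \<and> y \<in> verts m t \<and> (x, y) \<in> (product_graph a b)\<^sup>*}"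

definition brauer_category :: "(nat, vertex set set) inv_category" where
  "brauer_category =
    \<lparr>Ob = UNIV, Hom = brauer, Ident = (\<lambda>n. (\<lambda>i. {Upper i, Lower i}) ` {1..n}),
     Comp = brauer_mult, Star = (\<lambda>a. (`) swap_vertex ` a)\<rparr>"

definition brauer_odd :: "(nat, vertex set set) inv_category" where
  "brauer_odd = full_subcategory brauer_category {n. odd n}"


section \<open>Matrices\<close>

definition mat_category :: "(nat, 'k :: semiring_1 mat) inv_category" where
  "mat_category =
    \<lparr>Ob = UNIV, Hom = carrier_mat, Ident = 1\<^sub>m, Comp = (\<lambda>_ _ _ A B. A * B),
     Star = transpose_mat\<rparr>"

text \<open>To index the rows and columns of a matrix by the subsets of \<open>{1..n}\<close>, an ordering of these
  subsets is needed; \<open>e n\<close> lists them as \<open>e n 0, \<dots>, e n (2 ^ n - 1)\<close>.\<close>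

definition subset_enumeration :: "(nat \<Rightarrow> nat \<Rightarrow> nat set) \<Rightarrow> bool" where
  "subset_enumeration e \<longleftrightarrow> (\<forall>n. bij_betw (e n) {..<2 ^ n} (Pow {1..n}))"

lemma ex_subset_enumeration: "\<exists>e. subset_enumeration e"
proof -
  have "\<exists>h. bij_betw h {..<2 ^ n :: nat} (Pow {1..n})" for n :: nat
    using ex_bij_betw_nat_finite[of "Pow {1..n}"] by (simp add: card_Pow atLeast0LessThan)
  then show ?thesis
    unfolding subset_enumeration_def by metis
qed

definition bar ::
    "(nat \<Rightarrow> nat \<Rightarrow> nat set) \<Rightarrow> nat \<Rightarrow> nat \<Rightarrow> vertex set set \<Rightarrow> 'k :: semiring_1 mat" where
  "bar e m n a = mat (2 ^ m) (2 ^ n)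
    (\<lambda>(i, j). if \<exists>S\<subseteq>a. Upper ` e m i \<union> Lower ` e n j = \<Union>S then 1 else 0)"

definition bar1 ::
    "(nat \<Rightarrow> nat \<Rightarrow> nat set) \<Rightarrow> nat \<Rightarrow> nat \<Rightarrow> vertex set set \<Rightarrow> 'k :: semiring_1 mat" where
  "bar1 e m n a = submatrix (bar e m n a) {i. odd (card (e m i))} {j. odd (card (e n j))}"

definition bar0 ::
    "(nat \<Rightarrow> nat \<Rightarrow> nat set) \<Rightarrow> nat \<Rightarrow> nat \<Rightarrow> vertex set set \<Rightarrow> 'k :: semiring_1 mat" where
  "bar0 e m n a = submatrix (bar e m n a) {i. even (card (e m i))} {j. even (card (e n j))}"

end

theory Submission
  imports Defs
begin

text \<open>The matrix of a Brauer diagram \<open>a\<close> is the indicator of those pairs \<open>(X, Y)\<close> for which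
\<open>X \<union> Y'\<close> is a union of \<open>a\<close>-blocks. These pairs form a relation \<open>link a\<close> between subsets of \<open>{1..m}\<close>
and subsets of \<open>{1..n}\<close>. Over an additively idempotent semiring a sum of zeros and ones is \<open>1\<close> as
soon as one summand is, so the product of two indicator matrices is the indicator of the relational
composite. Hence everything reduces to facts about the relations.

\<^item> Functoriality is \<open>link (a b) = link a O link b\<close> (\<open>link_mult\<close>): a union of \<open>ab\<close>-blocks generates a
  union of components of the product graph, and the middle vertices of that union are the set
  through which the two relations are composed. All blocks have size two, so \<open>(X, Y) \<in> link a\<close> forces
  \<open>X\<close> and \<open>Y\<close> to have cardinalities of equal parity (\<open>link_parity\<close>); therefore the intermediate set
  has the same parity as its neighbours, and restricting to odd or to even sets respects products.

\<^item> Faithfulness: a partition is determined by its unions of blocks, because the blocks are the minimal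
  nonempty ones (\<open>partition_eqI_saturated\<close>). If \<open>m\<close> is odd, complementation in the vertex set
  maps unions of blocks to unions of blocks and exchanges odd with even upper parts, so either half
  of the relation determines the other half, and thereby \<open>a\<close> (\<open>link_inject_parity\<close>).

\<^item> The category laws of Brauer diagrams follow from those of relations, since \<open>link\<close> is injective.
  What needs an argument of its own is that the product of two diagrams has blocks of size two
  (\<open>pairing_glue\<close>): the components of the product graph are paths and cycles, the vertices of
  \<open>[m] \<union> [t]'\<close> are the ends of the paths, and every path has exactly two ends.\<close>

section \<open>Unions of blocks\<close>

definition saturated :: "'v set set \<Rightarrow> 'v set \<Rightarrow> bool" where
  "saturated P W \<longleftrightarrow> (\<exists>S\<subseteq>P. W = \<Union>S)"

lemma saturated_iff:
  assumes "partition_on V P"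
  shows "saturated P W \<longleftrightarrow> W \<subseteq> V \<and> (\<forall>B\<in>P. B \<inter> W \<noteq> {} \<longrightarrow> B \<subseteq> W)"
proof
  assume "saturated P W"
  then obtain S where S: "S \<subseteq> P" "W = \<Union>S"
    unfolding saturated_def by blast
  have "B \<subseteq> W" if B: "B \<in> P" "B \<inter> W \<noteq> {}" for B
  proof -
    obtain C where C: "C \<in> S" "B \<inter> C \<noteq> {}"
      using B(2) S(2) by blast
    then have "B = C"
      using partition_onD2[OF assms] B(1) S(1) by (auto dest: disjointD)
    then show ?thesis
      using C S(2) by blast
  qed
  then show "W \<subseteq> V \<and> (\<forall>B\<in>P. B \<inter> W \<noteq> {} \<longrightarrow> B \<subseteq> W)"
    using S partition_onD1[OF assms] by auto
next
  assume W: "W \<subseteq> V \<and> (\<forall>B\<in>P. B \<inter> W \<noteq> {} \<longrightarrow> B \<subseteq> W)"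
  have "W \<subseteq> \<Union>{B\<in>P. B \<subseteq> W}"
  proof
    fix x assume "x \<in> W"
    moreover from this obtain B where "B \<in> P" "x \<in> B"
      using W partition_onD1[OF assms] by auto
    ultimately show "x \<in> \<Union>{B\<in>P. B \<subseteq> W}"
      using W by auto
  qed
  then have "W = \<Union>{B\<in>P. B \<subseteq> W}"
    by auto
  then show "saturated P W"
    unfolding saturated_def by (intro exI[of _ "{B\<in>P. B \<subseteq> W}"]) simp
qed

lemma saturated_Diff:
  assumes "partition_on V P" and "saturated P W"
  shows "saturated P (V - W)"
proof -
  have "B \<subseteq> V - W" if "B \<in> P" "B \<inter> (V - W) \<noteq> {}" for B
  proof -
    have "B \<subseteq> V"
      using that(1) partition_onD1[OF assms(1)] by blast
    moreover have "B \<inter> W = {}"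
      using that assms(2) saturated_iff[OF assms(1), of W] by auto
    ultimately show ?thesis
      by blast
  qed
  then show ?thesis
    unfolding saturated_iff[OF assms(1)] by auto
qed

lemma block_saturated: "B \<in> P \<Longrightarrow> saturated P B"
  unfolding saturated_def by (rule exI[of _ "{B}"]) simp

lemma saturated_image:
  assumes "inj_on f V" and "\<Union>P \<subseteq> V" and "W \<subseteq> V"
  shows "saturated ((`) f ` P) (f ` W) \<longleftrightarrow> saturated P W"
proof
  assume "saturated P W"
  then obtain S where "S \<subseteq> P" "W = \<Union>S"
    unfolding saturated_def by blast
  then have "(`) f ` S \<subseteq> (`) f ` P \<and> f ` W = \<Union>((`) f ` S)"
    by auto
  then show "saturated ((`) f ` P) (f ` W)"
    unfolding saturated_def by (rule exI)
next
  assume "saturated ((`) f ` P) (f ` W)"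
  then obtain S where S: "S \<subseteq> P" "f ` W = \<Union>((`) f ` S)"
    unfolding saturated_def by (metis subset_imageE)
  have "f ` W = f ` \<Union>S"
    using S(2) by auto
  moreover have "\<Union>S \<subseteq> V"
    using S(1) assms(2) by blast
  ultimately have "W = \<Union>S"
    using assms(1,3) by (simp add: inj_on_image_eq_iff)
  then show "saturated P W"
    using S(1) unfolding saturated_def by blast
qed

text \<open>Each block of one partition is a union of blocks of the other, so it contains one of them; that one
is in turn a union of blocks of the first partition, which leaves only the block itself.\<close>
lemma partition_eqI_saturated:
  assumes P: "partition_on V P" and Q: "partition_on V Q"
    and eq: "\<And>W. saturated P W \<longleftrightarrow> saturated Q W"
  shows "P = Q"
proof -
  have "P' \<subseteq> Q'" if P': "partition_on V P'" and Q': "partition_on V Q'"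
    and eq': "\<And>W. saturated P' W \<longleftrightarrow> saturated Q' W" for P' Q'
  proof
    fix B assume B: "B \<in> P'"
    then have "B \<noteq> {}" "saturated Q' B"
      using partition_onD3[OF P'] eq' block_saturated by auto
    then obtain S where "S \<subseteq> Q'" "B = \<Union>S"
      unfolding saturated_def by auto
    with \<open>B \<noteq> {}\<close> obtain C where C: "C \<in> Q'" "C \<subseteq> B"
      by auto
    then have "C \<noteq> {}" "saturated P' C"
      using partition_onD3[OF Q'] eq' block_saturated by auto
    then have "B \<subseteq> C"
      using B C(2) saturated_iff[OF P', of C] by auto
    then show "B \<in> Q'"
      using C by auto
  qed
  from this[OF P Q eq] this[OF Q P eq[symmetric]] show ?thesis
    by (rule subset_antisym)
qed

section \<open>Partitions into pairs\<close>

definition pairing :: "'v set \<Rightarrow> 'v set set \<Rightarrow> bool" where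
  "pairing V P \<longleftrightarrow> partition_on V P \<and> (\<forall>B\<in>P. card B = 2)"

lemma brauer_pairing: "a \<in> brauer m n \<longleftrightarrow> pairing (verts m n) a"
  unfolding brauer_def pairing_def by simp

lemma pairing_partition: "pairing V P \<Longrightarrow> partition_on V P"
  unfolding pairing_def by simp

lemma pairing_image:
  assumes P: "pairing V P" and f: "inj_on f V"
  shows "pairing (f ` V) ((`) f ` P)"
  unfolding pairing_def
proof
  have "{} \<notin> P"
    using partition_onD3[OF pairing_partition[OF P]] .
  then have "(`) f ` P - {{}} = (`) f ` P"
    by auto
  then show "partition_on (f ` V) ((`) f ` P)"
    using partition_on_inj_image[OF pairing_partition[OF P] f] by simp
  have "inj_on f B" if "B \<in> P" for B
    by (rule inj_on_subset[OF f]) (use that partition_onD1[OF pairing_partition[OF P]] in blast)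
  then show "\<forall>B\<in>(`) f ` P. card B = 2"
    using P by (auto simp: pairing_def card_image)
qed

lemma even_card_saturated:
  assumes P: "pairing V P" and W: "saturated P W"
  shows "even (card W)"
proof -
  obtain S where S: "S \<subseteq> P" "W = \<Union>S"
    using W unfolding saturated_def by blast
  have card2: "card B = 2" if "B \<in> S" for B
    using that S(1) P by (auto simp: pairing_def)
  have "disjoint S"
    using partition_onD2[OF pairing_partition[OF P]] S(1) by (rule pairwise_subset)
  moreover have "finite B" if "B \<in> S" for B
    using card2[OF that] card.infinite by fastforce
  ultimately have "card W = (\<Sum>B\<in>S. card B)"
    unfolding S(2) by (intro card_Union_disjoint) auto
  also have "\<dots> = (\<Sum>B\<in>S. 2)"
    by (rule sum.cong) (auto simp: card2)
  finally show ?thesis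
    by simp
qed

section \<open>Alternating paths\<close>

definition joined :: "'v set set \<Rightarrow> 'v rel" where
  "joined P = {(x, y). \<exists>B\<in>P. x \<in> B \<and> y \<in> B}"

lemma sym_joined: "sym (joined P)"
  unfolding joined_def sym_def by blast

lemma joined_Un: "joined (P \<union> Q) = joined P \<union> joined Q"
  unfolding joined_def by blast

lemma saturated_joined:
  assumes "partition_on V P"
  shows "saturated P W \<longleftrightarrow> W \<subseteq> V \<and> joined P `` W \<subseteq> W"
proof -
  have "(\<forall>B\<in>P. B \<inter> W \<noteq> {} \<longrightarrow> B \<subseteq> W) \<longleftrightarrow> joined P `` W \<subseteq> W"
    unfolding joined_def by fast
  then show ?thesis
    by (simp only: saturated_iff[OF assms])
qed

lemma single_valued_joined:
  assumes P: "pairing V P"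
  shows "single_valued (joined P - Id)"
proof (rule single_valuedI)
  fix x y z assume "(x, y) \<in> joined P - Id" "(x, z) \<in> joined P - Id"
  then obtain B C where B: "B \<in> P" "x \<in> B" "y \<in> B" "x \<noteq> y"
    and C: "C \<in> P" "x \<in> C" "z \<in> C" "x \<noteq> z"
    unfolding joined_def by auto
  have "B = C"
    using partition_onD2[OF pairing_partition[OF P]] B C by (auto dest: disjointD)
  moreover have "card B = 2"
    using B P by (auto simp: pairing_def)
  ultimately show "y = z"
    using B C by (auto simp: card_2_iff)
qed

lemma Domain_joined:
  assumes "partition_on V P"
  shows "Domain (joined P) = V"
  using partition_onD1[OF assms] unfolding joined_def by auto

text \<open>Two matchings \<open>G True\<close> and \<open>G False\<close> form a graph of paths and cycles, in which a vertex missed by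
one of the matchings is the end of a path. Such a path has no third end: walking from \<open>x\<close> and
alternating between the matchings never offers a choice, so any two other ends reached are places
where the same deterministic walk stops, hence equal.\<close>
lemma path_ends_unique:
  fixes G :: "bool \<Rightarrow> 'v rel"
  assumes G: "\<And>c. single_valued (G c)" "\<And>c. sym (G c)"
    and x: "x \<notin> Domain (G c\<^sub>0)"
    and y: "y \<notin> Domain (G c\<^sub>1)" "y \<noteq> x" "(x, y) \<in> (G True \<union> G False)\<^sup>*"
    and z: "z \<notin> Domain (G c\<^sub>2)" "z \<noteq> x" "(x, z) \<in> (G True \<union> G False)\<^sup>*"
  shows "y = z"
proof -
  \<comment> \<open>A state \<open>(u, c)\<close> of the walk is at \<open>u\<close> and uses the matching \<open>G c\<close> next.\<close>
  define N where "N = {((u, c), (v, d)). (u, v) \<in> G c \<and> d = (\<not> c)}"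
  have "single_valued N"
    using G(1) unfolding N_def single_valued_def by blast
  \<comment> \<open>The walk misses nothing: a neighbour of a visited vertex is either its successor or
    its predecessor on the walk, and the start \<open>x\<close> has only a successor.\<close>
  have visited: "\<exists>c. ((x, \<not> c\<^sub>0), (v, c)) \<in> N\<^sup>*" if "(x, v) \<in> (G True \<union> G False)\<^sup>*" for v
    using that
  proof (induction rule: rtrancl_induct)
    case base
    then show ?case by blast
  next
    case (step v w)
    then obtain c d where c: "((x, \<not> c\<^sub>0), (v, c)) \<in> N\<^sup>*" and d: "(v, w) \<in> G d"
      by (metis UnE)
    show ?case
    proof (cases "d = c")
      case True
      then have "((v, c), (w, \<not> c)) \<in> N"
        using d by (simp add: N_def)
      then show ?thesis
        using c by (meson rtrancl.rtrancl_into_rtrancl)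
    next
      case False
      show ?thesis
        using c
      proof (cases rule: rtranclE)
        case base
        then show ?thesis
          using d x False by auto
      next
        case (step s)
        obtain u b where s: "s = (u, b)"
          by fastforce
        then have "(u, v) \<in> G b" "c = (\<not> b)"
          using step(2) by (auto simp: N_def)
        then have "u = w"
          using d False G by (cases b) (auto dest: single_valuedD symD)
        then show ?thesis
          using step(1) s by blast
      qed
    qed
  qed
  have stuck: "\<exists>c. ((x, \<not> c\<^sub>0), (v, c)) \<in> N\<^sup>* \<and> (\<forall>t. ((v, c), t) \<in> N\<^sup>* \<longrightarrow> t = (v, c))"
    if v: "v \<notin> Domain (G c')" "v \<noteq> x" "(x, v) \<in> (G True \<union> G False)\<^sup>*" for v c'
  proof -
    obtain c where c: "((x, \<not> c\<^sub>0), (v, c)) \<in> N\<^sup>*"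
      using visited v(3) by blast
    then obtain u b where "((u, b), (v, c)) \<in> N"
      using v(2) by (cases rule: rtranclE) auto
    then have "(v, u) \<in> G (\<not> c)"
      using G(2) by (auto simp: N_def dest: symD)
    then have "v \<notin> Domain (G c)"
      using v(1) by (cases "c' = c") auto
    then have "\<forall>t. ((v, c), t) \<notin> N"
      by (auto simp: N_def)
    then have "\<forall>t. ((v, c), t) \<in> N\<^sup>* \<longrightarrow> t = (v, c)"
      by (auto elim: converse_rtranclE)
    then show ?thesis
      using c by blast
  qed
  obtain c d where
      c: "((x, \<not> c\<^sub>0), (y, c)) \<in> N\<^sup>*" "\<forall>t. ((y, c), t) \<in> N\<^sup>* \<longrightarrow> t = (y, c)"
    and d: "((x, \<not> c\<^sub>0), (z, d)) \<in> N\<^sup>*" "\<forall>t. ((z, d), t) \<in> N\<^sup>* \<longrightarrow> t = (z, d)"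
    using stuck[OF y] stuck[OF z] by blast
  then show ?thesis
    using single_valued_confluent[OF \<open>single_valued N\<close> c(1) d(1)] by auto
qed

section \<open>Gluing two pairings\<close>

text \<open>This is the composition of Brauer diagrams without the bookkeeping of upper, middle and lower
vertices: two partitions whose ground sets overlap are joined along the common vertices, and only
the vertices outside the overlap are kept.\<close>
definition glue :: "'v set set \<Rightarrow> 'v set set \<Rightarrow> 'v set set" where
  "glue P Q = (let D = (\<Union>P - \<Union>Q) \<union> (\<Union>Q - \<Union>P)
     in D // {(x, y). x \<in> D \<and> y \<in> D \<and> (x, y) \<in> (joined P \<union> joined Q)\<^sup>*})"

lemma equiv_components:
  assumes "sym R"
  shows "equiv D {(x, y). x \<in> D \<and> y \<in> D \<and> (x, y) \<in> R\<^sup>*}"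
proof (rule equivI)
  show "sym {(x, y). x \<in> D \<and> y \<in> D \<and> (x, y) \<in> R\<^sup>*}"
    using sym_rtrancl[OF assms] by (auto simp: sym_def)
qed (auto simp: refl_on_def trans_def)

lemma saturated_quotient:
  assumes "equiv D r"
  shows "saturated (D // r) W \<longleftrightarrow> W \<subseteq> D \<and> r `` W \<subseteq> W"
proof -
  have mem: "r `` {x} \<in> D // r" if "x \<in> D" for x
    using that by (rule quotientI)
  have rep: "\<exists>x\<in>D. B = r `` {x}" if "B \<in> D // r" for B
    using that by (auto elim: quotientE)
  have sub: "W \<subseteq> D \<Longrightarrow> (\<forall>B\<in>D // r. B \<inter> W \<noteq> {} \<longrightarrow> B \<subseteq> W) \<longleftrightarrow> r `` W \<subseteq> W"
  proof
    assume W: "W \<subseteq> D" "\<forall>B\<in>D // r. B \<inter> W \<noteq> {} \<longrightarrow> B \<subseteq> W"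
    show "r `` W \<subseteq> W"
    proof
      fix y assume "y \<in> r `` W"
      then obtain x where x: "x \<in> W" "(x, y) \<in> r"
        by auto
      then have "x \<in> r `` {x}"
        using W(1) equiv_class_self[OF assms] by auto
      then have "r `` {x} \<inter> W \<noteq> {}"
        using x(1) by auto
      moreover have "r `` {x} \<in> D // r"
        using x(1) W(1) mem by auto
      ultimately have "r `` {x} \<subseteq> W"
        using W(2) by auto
      then show "y \<in> W"
        using x(2) by auto
    qed
  next
    assume W: "W \<subseteq> D" "r `` W \<subseteq> W"
    show "\<forall>B\<in>D // r. B \<inter> W \<noteq> {} \<longrightarrow> B \<subseteq> W"
    proof (intro ballI impI)
      fix B assume "B \<in> D // r" "B \<inter> W \<noteq> {}"
      then obtain x y where xy: "B = r `` {x}" "y \<in> B" "y \<in> W" "(x, y) \<in> r"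
        using rep[of B] by auto
      have "B = r `` {y}"
        using xy(1) equiv_class_eq[OF assms xy(4)] by (rule trans)
      then show "B \<subseteq> W"
        using xy(3) W(2) by auto
    qed
  qed
  show ?thesis
    using sub by (auto simp: saturated_iff[OF partition_on_quotient[OF assms]])
qed

lemma glue_eq:
  assumes "partition_on V P" and "partition_on U Q" and "D = (V - U) \<union> (U - V)"
  shows "glue P Q = D // {(x, y). x \<in> D \<and> y \<in> D \<and> (x, y) \<in> (joined P \<union> joined Q)\<^sup>*}"
  unfolding glue_def assms(3) Let_def
  by (simp only: partition_onD1[OF assms(1), symmetric] partition_onD1[OF assms(2), symmetric])

lemma partition_glue:
  assumes "partition_on V P" and "partition_on U Q" and "D = (V - U) \<union> (U - V)"
  shows "partition_on D (glue P Q)"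
  unfolding glue_eq[OF assms]
  by (intro partition_on_quotient equiv_components sym_Un sym_joined)

text \<open>A set closed under the components of the joint graph restricts to unions of \<open>P\<close>-blocks and of
\<open>Q\<close>-blocks that agree on the overlap \<open>V \<inter> U\<close>, and conversely two such unions fit together. The set \<open>Z\<close>
is their common trace on the overlap; it need not be unique, as a cycle inside the overlap may be
added to it.\<close>
lemma saturated_glue:
  assumes P: "partition_on V P" and Q: "partition_on U Q" and D: "D = (V - U) \<union> (U - V)"
  shows "saturated (glue P Q) W \<longleftrightarrow>
    W \<subseteq> D \<and> (\<exists>Z\<subseteq>V \<inter> U. saturated P ((W \<inter> V) \<union> Z) \<and> saturated Q ((W \<inter> U) \<union> Z))"
proof -
  define R where "R = joined P \<union> joined Q"
  define r where "r = {(x, y). x \<in> D \<and> y \<in> D \<and> (x, y) \<in> R\<^sup>*}"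
  have "sym R"
    unfolding R_def by (intro sym_Un sym_joined)
  then have glue: "saturated (glue P Q) W \<longleftrightarrow> W \<subseteq> D \<and> r `` W \<subseteq> W"
    unfolding glue_eq[OF assms] r_def R_def[symmetric]
    by (intro saturated_quotient equiv_components)
  have domP: "joined P \<subseteq> V \<times> V" and domQ: "joined Q \<subseteq> U \<times> U"
    using partition_onD1[OF P] partition_onD1[OF Q] by (auto simp: joined_def)
  show ?thesis
  proof
    assume "saturated (glue P Q) W"
    then have W: "W \<subseteq> D" "r `` W \<subseteq> W"
      using glue by auto
    define C where "C = R\<^sup>* `` W"
    have closed: "R `` C \<subseteq> C"
      unfolding C_def by (auto intro: rtrancl.rtrancl_into_rtrancl)
    have "C \<inter> D = W"
      using W by (auto simp: C_def r_def)
    then have "(W \<inter> V) \<union> (C \<inter> V \<inter> U) = C \<inter> V" "(W \<inter> U) \<union> (C \<inter> V \<inter> U) = C \<inter> U"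
      using D by auto
    moreover have "saturated P (C \<inter> V)" "saturated Q (C \<inter> U)"
      unfolding saturated_joined[OF P] saturated_joined[OF Q]
      using closed domP domQ by (auto simp: R_def)
    ultimately show "W \<subseteq> D \<and>
        (\<exists>Z\<subseteq>V \<inter> U. saturated P ((W \<inter> V) \<union> Z) \<and> saturated Q ((W \<inter> U) \<union> Z))"
      using W(1) by (intro conjI exI[of _ "C \<inter> V \<inter> U"]) auto
  next
    assume "W \<subseteq> D \<and>
        (\<exists>Z\<subseteq>V \<inter> U. saturated P ((W \<inter> V) \<union> Z) \<and> saturated Q ((W \<inter> U) \<union> Z))"
    then obtain Z where W: "W \<subseteq> D" and Z: "Z \<subseteq> V \<inter> U"
      and sat: "saturated P ((W \<inter> V) \<union> Z)" "saturated Q ((W \<inter> U) \<union> Z)"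
      by blast
    have "joined P `` (W \<union> Z) \<subseteq> W \<union> Z"
      using sat(1) domP Z unfolding saturated_joined[OF P] by fast
    moreover have "joined Q `` (W \<union> Z) \<subseteq> W \<union> Z"
      using sat(2) domQ Z unfolding saturated_joined[OF Q] by fast
    ultimately have "R `` (W \<union> Z) \<subseteq> W \<union> Z"
      unfolding R_def by auto
    then have "R\<^sup>* `` (W \<union> Z) = W \<union> Z"
      by (rule Image_closed_trancl)
    then have "r `` W \<subseteq> (W \<union> Z) \<inter> D"
      unfolding r_def by auto
    moreover have "(W \<union> Z) \<inter> D = W"
      using W Z D by auto
    ultimately show "saturated (glue P Q) W"
      unfolding glue using W by simp
  qed
qed

text \<open>A block \<open>B\<close> of \<open>glue P Q\<close> has at most two elements, because the kept vertices of one component are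
ends of one alternating path. It is nonempty, and its size is even: with \<open>Z\<close> the trace of its
component on the overlap, both \<open>(B \<inter> V) \<union> Z\<close> and \<open>(B \<inter> U) \<union> Z\<close> are unions of pairs, and their sizes add
up to \<open>card B + 2 * card Z\<close>.\<close>
lemma pairing_glue:
  assumes P: "pairing V P" and Q: "pairing U Q" and D: "D = (V - U) \<union> (U - V)"
    and fin: "finite V" "finite U"
  shows "pairing D (glue P Q)"
  unfolding pairing_def
proof
  note part = pairing_partition[OF P] pairing_partition[OF Q] D
  show part_glue: "partition_on D (glue P Q)"
    by (rule partition_glue[OF part])
  define R where "R = joined P \<union> joined Q"
  define G where "G c = (if c then joined P - Id else joined Q - Id)" for c
  have "G True \<union> G False = R - Id"
    unfolding G_def R_def by auto
  then have GR: "(G True \<union> G False)\<^sup>* = R\<^sup>*"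
    by (simp add: rtrancl_r_diff_Id)
  have G: "single_valued (G c)" "sym (G c)" for c
    unfolding G_def using single_valued_joined[OF P] single_valued_joined[OF Q]
      sym_joined[of P] sym_joined[of Q] by (auto simp: sym_def)
  have "Domain (G True) \<subseteq> V" "Domain (G False) \<subseteq> U"
    using Domain_joined[OF part(1)] Domain_joined[OF part(2)] by (auto simp: G_def)
  then have end_D: "\<exists>c. x \<notin> Domain (G c)" if "x \<in> D" for x
  proof (cases "x \<in> V")
    case True
    then have "x \<notin> Domain (G False)"
      using that D \<open>Domain (G False) \<subseteq> U\<close> by blast
    then show ?thesis ..
  next
    case False
    then have "x \<notin> Domain (G True)"
      using \<open>Domain (G True) \<subseteq> V\<close> by blast
    then show ?thesis ..
  qed
  show "\<forall>B\<in>glue P Q. card B = 2"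
  proof
    fix B assume B: "B \<in> glue P Q"
    then obtain x where x: "x \<in> D" "B = {y \<in> D. (x, y) \<in> R\<^sup>*}"
      unfolding glue_eq[OF part] R_def by (auto elim!: quotientE)
    have "saturated (glue P Q) B"
      using B by (rule block_saturated)
    then obtain Z where "B \<subseteq> D" and Z: "Z \<subseteq> V \<inter> U"
      and "saturated P ((B \<inter> V) \<union> Z)" "saturated Q ((B \<inter> U) \<union> Z)"
      unfolding saturated_glue[OF part] by auto
    then have even: "even (card ((B \<inter> V) \<union> Z))" "even (card ((B \<inter> U) \<union> Z))"
      using even_card_saturated P Q by auto
    have fin': "finite B" "finite Z"
      using \<open>B \<subseteq> D\<close> Z D fin by (auto intro: finite_subset)
    have "card ((B \<inter> V) \<union> Z) = card (B \<inter> V) + card Z"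
      using fin' \<open>B \<subseteq> D\<close> Z D by (intro card_Un_disjoint) auto
    moreover have "card ((B \<inter> U) \<union> Z) = card (B \<inter> U) + card Z"
      using fin' \<open>B \<subseteq> D\<close> Z D by (intro card_Un_disjoint) auto
    moreover have "card ((B \<inter> V) \<union> (B \<inter> U)) = card (B \<inter> V) + card (B \<inter> U)"
      using fin' \<open>B \<subseteq> D\<close> D by (intro card_Un_disjoint) auto
    moreover have "(B \<inter> V) \<union> (B \<inter> U) = B"
      using \<open>B \<subseteq> D\<close> D by auto
    ultimately have "card B + 2 * card Z = card ((B \<inter> V) \<union> Z) + card ((B \<inter> U) \<union> Z)"
      by simp
    then have "even (card B + 2 * card Z)"
      using even by simp
    then have "even (card B)"
      by simp
    then have "B \<noteq> {x}"
      by auto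
    moreover have "x \<in> B"
      using x by auto
    ultimately obtain y where y: "y \<in> B" "y \<noteq> x"
      by auto
    have "z = y" if z: "z \<in> B" "z \<noteq> x" for z
    proof -
      obtain c\<^sub>0 c\<^sub>1 c\<^sub>2 where
        "x \<notin> Domain (G c\<^sub>0)" "z \<notin> Domain (G c\<^sub>1)" "y \<notin> Domain (G c\<^sub>2)"
        using end_D[of x] end_D[of y] end_D[of z] x y(1) z(1) by blast
      moreover have "(x, y) \<in> (G True \<union> G False)\<^sup>*" "(x, z) \<in> (G True \<union> G False)\<^sup>*"
        unfolding GR using x(2) y(1) z(1) by simp_all
      ultimately show ?thesis
        using path_ends_unique[of G x c\<^sub>0 z c\<^sub>1 y c\<^sub>2] G y(2) z(2) by blast
    qed
    then have "B = {x, y}"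
      using \<open>x \<in> B\<close> y(1) by auto
    then show "card B = 2"
      using y(2) by simp
  qed
qed

section \<open>Composition of Brauer diagrams\<close>

lemma verts_product:
  "verts m t = (Upper ` {1..m} \<union> Middle ` {1..n} - (Middle ` {1..n} \<union> Lower ` {1..t}))
     \<union> (Middle ` {1..n} \<union> Lower ` {1..t} - (Upper ` {1..m} \<union> Middle ` {1..n}))"
  unfolding verts_def by auto

lemma lower_to_middle_Un:
  "lower_to_middle ` (Upper ` X \<union> Lower ` Y) = Upper ` X \<union> Middle ` Y"
  by (auto simp: image_Un image_image)

lemma upper_to_middle_Un:
  "upper_to_middle ` (Upper ` X \<union> Lower ` Y) = Middle ` X \<union> Lower ` Y"
  by (auto simp: image_Un image_image)

lemma swap_vertex_Un:
  "swap_vertex ` (Upper ` X \<union> Lower ` Y) = Upper ` Y \<union> Lower ` X"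
  by (auto simp: image_Un image_image)

lemma inj_on_rename:
  "inj_on lower_to_middle (verts m n)" "inj_on upper_to_middle (verts m n)"
  "inj_on swap_vertex (verts m n)"
  by (auto simp: inj_on_def verts_def)

lemma brauer_rename:
  assumes "a \<in> brauer m n"
  shows "pairing (Upper ` {1..m} \<union> Middle ` {1..n}) ((`) lower_to_middle ` a)"
    and "pairing (Middle ` {1..m} \<union> Lower ` {1..n}) ((`) upper_to_middle ` a)"
    and "(`) swap_vertex ` a \<in> brauer n m"
  using pairing_image[OF assms[unfolded brauer_pairing] inj_on_rename(1)]
    pairing_image[OF assms[unfolded brauer_pairing] inj_on_rename(2)]
    pairing_image[OF assms[unfolded brauer_pairing] inj_on_rename(3)]
  by (simp_all add: brauer_pairing verts_def lower_to_middle_Un upper_to_middle_Un swap_vertex_Un)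

lemma brauer_mult_glue:
  assumes "a \<in> brauer m n" and "b \<in> brauer n t"
  shows "brauer_mult m n t a b = glue ((`) lower_to_middle ` a) ((`) upper_to_middle ` b)"
  unfolding brauer_mult_def
    glue_eq[OF pairing_partition[OF brauer_rename(1)[OF assms(1)]]
      pairing_partition[OF brauer_rename(2)[OF assms(2)]] verts_product]
  unfolding joined_Un[symmetric] unfolding product_graph_def joined_def ..

lemma brauer_mult_closed:
  assumes "a \<in> brauer m n" and "b \<in> brauer n t"
  shows "brauer_mult m n t a b \<in> brauer m t"
  unfolding brauer_pairing brauer_mult_glue[OF assms]
  by (rule pairing_glue[OF brauer_rename(1)[OF assms(1)] brauer_rename(2)[OF assms(2)] verts_product])
    auto

section \<open>The relation of a Brauer diagram\<close>

text \<open>The support of the matrix \<open>bar e m n a\<close>, free of the enumeration \<open>e\<close>.\<close>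
definition link :: "vertex set set \<Rightarrow> nat set rel" where
  "link a = {(X, Y). saturated a (Upper ` X \<union> Lower ` Y)}"

lemma brauer_partition: "a \<in> brauer m n \<Longrightarrow> partition_on (verts m n) a"
  unfolding brauer_def by simp

lemma verts_mono: "X \<subseteq> {1..m} \<Longrightarrow> Y \<subseteq> {1..n} \<Longrightarrow> Upper ` X \<union> Lower ` Y \<subseteq> verts m n"
  unfolding verts_def by blast

lemma link_bounds:
  assumes "a \<in> brauer m n" and "(X, Y) \<in> link a"
  shows "X \<subseteq> {1..m}" and "Y \<subseteq> {1..n}"
proof -
  have "Upper ` X \<union> Lower ` Y \<subseteq> verts m n"
    using assms(2) by (simp add: link_def saturated_iff[OF brauer_partition[OF assms(1)]])
  then show "X \<subseteq> {1..m}" "Y \<subseteq> {1..n}"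
    unfolding verts_def by blast+
qed

lemma link_parity:
  assumes "a \<in> brauer m n" and "(X, Y) \<in> link a"
  shows "odd (card X) \<longleftrightarrow> odd (card Y)"
proof -
  have fin: "finite X" "finite Y"
    using link_bounds[OF assms] by (auto intro: finite_subset)
  have "card (Upper ` X \<union> Lower ` Y) = card (Upper ` X) + card (Lower ` Y)"
    using fin by (intro card_Un_disjoint) auto
  also have "\<dots> = card X + card Y"
    by (simp add: card_image inj_on_def)
  finally have "even (card X + card Y)"
    using even_card_saturated assms unfolding brauer_pairing link_def by fastforce
  then show ?thesis
    by simp
qed

lemma link_complement:
  assumes "a \<in> brauer m n" and "(X, Y) \<in> link a"
  shows "({1..m} - X, {1..n} - Y) \<in> link a"
proof -
  have "verts m n - (Upper ` X \<union> Lower ` Y) = Upper ` ({1..m} - X) \<union> Lower ` ({1..n} - Y)"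
    unfolding verts_def by auto
  moreover have "saturated a (verts m n - (Upper ` X \<union> Lower ` Y))"
    using assms(2) by (intro saturated_Diff[OF brauer_partition[OF assms(1)]]) (simp add: link_def)
  ultimately show ?thesis
    by (simp only: link_def mem_Collect_eq prod.case)
qed

lemma link_inject:
  assumes "a \<in> brauer m n" and "b \<in> brauer m n" and "link a = link b"
  shows "a = b"
proof (rule partition_eqI_saturated[OF brauer_partition[OF assms(1)] brauer_partition[OF assms(2)]])
  fix W
  show "saturated a W \<longleftrightarrow> saturated b W"
  proof (cases "W \<subseteq> verts m n")
    case True
    then have "W = Upper ` {i. Upper i \<in> W} \<union> Lower ` {i. Lower i \<in> W}"
      unfolding verts_def by auto
    then obtain X Y where "W = Upper ` X \<union> Lower ` Y"
      by blast
    moreover have "(X, Y) \<in> link a \<longleftrightarrow> (X, Y) \<in> link b"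
      using assms(3) by simp
    ultimately show ?thesis
      by (simp add: link_def)
  next
    case False
    then show ?thesis
      by (simp add: saturated_iff[OF brauer_partition[OF assms(1)]]
          saturated_iff[OF brauer_partition[OF assms(2)]])
  qed
qed

lemma odd_card_complement:
  fixes m :: nat and X :: "nat set"
  assumes "odd m" and "X \<subseteq> {1..m}"
  shows "odd (card ({1..m} - X)) \<longleftrightarrow> even (card X)"
proof -
  have "card X \<le> m"
    using card_mono[OF _ assms(2)] by simp
  then show ?thesis
    using assms by (simp add: card_Diff_subset finite_subset)
qed

text \<open>A pair \<open>(X, Y)\<close> whose upper part has the wrong parity is replaced by its complement
\<open>({1..m} - X, {1..n} - Y)\<close>, which has the right one since \<open>m\<close> is odd, and which belongs to the relation
exactly when \<open>(X, Y)\<close> does.\<close>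
lemma link_inject_parity:
  assumes a: "a \<in> brauer m n" and b: "b \<in> brauer m n" and "odd m"
    and eq: "\<And>X Y. odd (card X) = p \<Longrightarrow> (X, Y) \<in> link a \<longleftrightarrow> (X, Y) \<in> link b"
  shows "a = b"
proof (rule link_inject[OF a b])
  have "link c \<subseteq> link d"
    if c: "c \<in> brauer m n" and d: "d \<in> brauer m n"
      and cd: "\<And>X Y. odd (card X) = p \<Longrightarrow> (X, Y) \<in> link c \<Longrightarrow> (X, Y) \<in> link d" for c d
  proof (rule subrelI)
    fix X Y assume XY: "(X, Y) \<in> link c"
    note bounds = link_bounds[OF c XY]
    show "(X, Y) \<in> link d"
    proof (cases "odd (card X) = p")
      case True
      then show ?thesis
        using cd XY by blast
    next
      case False
      then have "odd (card ({1..m} - X)) = p"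
        using odd_card_complement[OF \<open>odd m\<close> bounds(1)] by auto
      then have "({1..m} - X, {1..n} - Y) \<in> link d"
        using cd link_complement[OF c XY] by blast
      from link_complement[OF d this] show ?thesis
        using bounds by (simp add: double_diff)
    qed
  qed
  from this[OF a b] this[OF b a] eq show "link a = link b"
    by blast
qed

text \<open>This is \<open>saturated_glue\<close> read off on the three rows of vertices: the overlap is the middle row, so
the trace on it is the intermediate set of the relational composite.\<close>
lemma link_mult:
  assumes a: "a \<in> brauer m n" and b: "b \<in> brauer n t"
  shows "link (brauer_mult m n t a b) = link a O link b"
proof -
  note part = pairing_partition[OF brauer_rename(1)[OF a]]
    pairing_partition[OF brauer_rename(2)[OF b]] verts_product
  have "\<Union>a \<subseteq> verts m n" "\<Union>b \<subseteq> verts n t"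
    using partition_onD1[OF brauer_partition] a b by blast+
  note sat_a = saturated_image[OF inj_on_rename(1)[of m n] this(1)]
    and sat_b = saturated_image[OF inj_on_rename(2)[of n t] this(2)]
  have aP: "saturated ((`) lower_to_middle ` a) (Upper ` X \<union> Middle ` Z) \<longleftrightarrow> (X, Z) \<in> link a"
    if "X \<subseteq> {1..m}" "Z \<subseteq> {1..n}" for X Z
    using sat_a[OF verts_mono[OF that]] unfolding lower_to_middle_Un link_def by simp
  have bQ: "saturated ((`) upper_to_middle ` b) (Middle ` Z \<union> Lower ` Y) \<longleftrightarrow> (Z, Y) \<in> link b"
    if "Z \<subseteq> {1..n}" "Y \<subseteq> {1..t}" for Z Y
    using sat_b[OF verts_mono[OF that]] unfolding upper_to_middle_Un link_def by simp
  have "(X, Y) \<in> link (brauer_mult m n t a b) \<longleftrightarrow> (X, Y) \<in> link a O link b" for X Y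
  proof (cases "X \<subseteq> {1..m} \<and> Y \<subseteq> {1..t}")
    case False
    then have "(X, Y) \<notin> link (brauer_mult m n t a b)"
      using link_bounds[OF brauer_mult_closed[OF a b], of X Y] by auto
    moreover have "(X, Y) \<notin> link a O link b"
      using False link_bounds(1)[OF a, of X] link_bounds(2)[OF b, of _ Y] by auto
    ultimately show ?thesis
      by simp
  next
    case True
    define W where "W = Upper ` X \<union> Lower ` Y"
    have "W \<subseteq> verts m t"
      using True unfolding W_def by (intro verts_mono) simp_all
    have ex_subset: "(\<exists>Z\<subseteq>Middle ` A. \<Phi> Z) \<longleftrightarrow> (\<exists>Z\<subseteq>A. \<Phi> (Middle ` Z))" for A \<Phi>
      by (auto simp: subset_image_iff)
    have middle: "(Upper ` {1..m} \<union> Middle ` {1..n}) \<inter> (Middle ` {1..n} \<union> Lower ` {1..t})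
        = Middle ` {1..n}"
      by auto
    have W: "W \<inter> (Upper ` {1..m} \<union> Middle ` {1..n}) = Upper ` X"
        "W \<inter> (Middle ` {1..n} \<union> Lower ` {1..t}) = Lower ` Y"
      using True unfolding W_def by auto
    have "(X, Y) \<in> link (brauer_mult m n t a b) \<longleftrightarrow>
        saturated (glue ((`) lower_to_middle ` a) ((`) upper_to_middle ` b)) W"
      unfolding link_def W_def by (simp add: brauer_mult_glue[OF a b])
    also have "\<dots> \<longleftrightarrow> (\<exists>Z\<subseteq>Middle ` {1..n}. saturated ((`) lower_to_middle ` a) (Upper ` X \<union> Z)
        \<and> saturated ((`) upper_to_middle ` b) (Lower ` Y \<union> Z))"
      using \<open>W \<subseteq> verts m t\<close> unfolding saturated_glue[OF part] middle W by simp
    also have "\<dots> \<longleftrightarrow> (\<exists>Z\<subseteq>{1..n}. saturated ((`) lower_to_middle ` a) (Upper ` X \<union> Middle ` Z)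
        \<and> saturated ((`) upper_to_middle ` b) (Middle ` Z \<union> Lower ` Y))"
      unfolding ex_subset by (simp only: Un_commute)
    also have "\<dots> \<longleftrightarrow> (\<exists>Z\<subseteq>{1..n}. (X, Z) \<in> link a \<and> (Z, Y) \<in> link b)"
      using True aP bQ by (intro ex_cong1) auto
    also have "\<dots> \<longleftrightarrow> (X, Y) \<in> link a O link b"
      using link_bounds(2)[OF a] by blast
    finally show ?thesis .
  qed
  then show ?thesis
    by auto
qed

lemma brauer_id: "(\<lambda>i. {Upper i, Lower i}) ` {1..n} \<in> brauer n n"
proof -
  let ?a = "(\<lambda>i. {Upper i, Lower i}) ` {1..n}"
  have "partition_on (verts n n) ?a"
  proof (rule partition_onI)
    show "\<Union>?a = verts n n"
      unfolding verts_def by auto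
    show "disjnt p q" if "p \<in> ?a" "q \<in> ?a" "p \<noteq> q" for p q
      using that by (auto simp: disjnt_def)
  qed auto
  then show ?thesis
    unfolding brauer_def by auto
qed

lemma link_id: "link ((\<lambda>i. {Upper i, Lower i}) ` {1..n}) = Id_on (Pow {1..n})"
proof -
  have "(X, Y) \<in> link ((\<lambda>i. {Upper i, Lower i}) ` {1..n}) \<longleftrightarrow> X = Y \<and> X \<subseteq> {1..n}" for X Y
  proof -
    let ?W = "Upper ` X \<union> Lower ` Y"
    have "?W \<subseteq> verts n n \<longleftrightarrow> X \<subseteq> {1..n} \<and> Y \<subseteq> {1..n}"
      unfolding verts_def by blast
    moreover have "({Upper i, Lower i} \<inter> ?W \<noteq> {} \<longrightarrow> {Upper i, Lower i} \<subseteq> ?W)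
        \<longleftrightarrow> (i \<in> X \<longleftrightarrow> i \<in> Y)" for i
      by auto
    ultimately have "saturated ((\<lambda>i. {Upper i, Lower i}) ` {1..n}) ?W \<longleftrightarrow>
        X \<subseteq> {1..n} \<and> Y \<subseteq> {1..n} \<and> (\<forall>i\<in>{1..n}. i \<in> X \<longleftrightarrow> i \<in> Y)"
      unfolding saturated_iff[OF brauer_partition[OF brauer_id]]
      by (simp only: ball_simps conj_assoc)
    then show ?thesis
      unfolding link_def by auto
  qed
  then show ?thesis
    by (auto simp: Id_on_iff)
qed

lemma Id_on_link:
  assumes "a \<in> brauer m n"
  shows "Id_on (Pow {1..m}) O link a = link a"
proof (intro equalityI subrelI)
  fix X Y assume "(X, Y) \<in> link a"
  then show "(X, Y) \<in> Id_on (Pow {1..m}) O link a"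
    using link_bounds(1)[OF assms, of X Y] by (intro relcompI[of X X]) auto
qed auto

lemma link_Id_on:
  assumes "a \<in> brauer m n"
  shows "link a O Id_on (Pow {1..n}) = link a"
proof (intro equalityI subrelI)
  fix X Y assume "(X, Y) \<in> link a"
  then show "(X, Y) \<in> link a O Id_on (Pow {1..n})"
    using link_bounds(2)[OF assms, of X Y] by (intro relcompI[of X Y]) auto
qed auto

lemma link_swap:
  assumes "a \<in> brauer m n"
  shows "link ((`) swap_vertex ` a) = (link a)\<inverse>"
proof -
  have "(Y, X) \<in> link ((`) swap_vertex ` a) \<longleftrightarrow> (X, Y) \<in> link a" for X Y
  proof (cases "X \<subseteq> {1..m} \<and> Y \<subseteq> {1..n}")
    case False
    then show ?thesis
      using link_bounds[OF brauer_rename(3)[OF assms], of Y X] link_bounds[OF assms, of X Y] by auto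
  next
    case True
    then have "Upper ` X \<union> Lower ` Y \<subseteq> verts m n"
      by (intro verts_mono) simp_all
    then show ?thesis
      using saturated_image[OF inj_on_rename(3)[of m n], of a "Upper ` X \<union> Lower ` Y"]
        partition_onD1[OF brauer_partition[OF assms]]
      unfolding swap_vertex_Un link_def by simp
  qed
  then show ?thesis
    by auto
qed

section \<open>The Brauer category is a category with involution\<close>

text \<open>Associativity and the unit laws are inherited from relations, because \<open>link\<close> is injective and turns
composition into relational composition.\<close>
lemma inv_category_brauer: "inv_category brauer_category"
proof
  have [simp]: "Ob brauer_category = UNIV" "Hom brauer_category = brauer"
    "Ident brauer_category = (\<lambda>n. (\<lambda>i. {Upper i, Lower i}) ` {1..n})"
    "Comp brauer_category = brauer_mult" "Star brauer_category = (\<lambda>a. (`) swap_vertex ` a)"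
    by (simp_all add: brauer_category_def)
  note One_nat_def [simp del]
  fix w x y z a b c
  show "Ident brauer_category x \<in> Hom brauer_category x x"
    by (simp add: brauer_id)
  show "Comp brauer_category x y z a b \<in> Hom brauer_category x z"
    if "a \<in> Hom brauer_category x y" "b \<in> Hom brauer_category y z"
    using that by (simp add: brauer_mult_closed)
  show "Comp brauer_category x x y (Ident brauer_category x) a = a"
    if "a \<in> Hom brauer_category x y"
  proof (rule link_inject)
    have a: "a \<in> brauer x y"
      using that by simp
    show "Comp brauer_category x x y (Ident brauer_category x) a \<in> brauer x y"
      using a by (simp add: brauer_mult_closed brauer_id)
    show "link (Comp brauer_category x x y (Ident brauer_category x) a) = link a"
      by (simp add: link_mult[OF brauer_id a] link_id Id_on_link[OF a])
  qed (use that in simp)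
  show "Comp brauer_category x y y a (Ident brauer_category y) = a"
    if "a \<in> Hom brauer_category x y"
  proof (rule link_inject)
    have a: "a \<in> brauer x y"
      using that by simp
    show "Comp brauer_category x y y a (Ident brauer_category y) \<in> brauer x y"
      using a by (simp add: brauer_mult_closed brauer_id)
    show "link (Comp brauer_category x y y a (Ident brauer_category y)) = link a"
      by (simp add: link_mult[OF a brauer_id] link_id link_Id_on[OF a])
  qed (use that in simp)
  show "Comp brauer_category w y z (Comp brauer_category w x y a b) c =
      Comp brauer_category w x z a (Comp brauer_category x y z b c)"
    if "a \<in> Hom brauer_category w x" "b \<in> Hom brauer_category x y"
      "c \<in> Hom brauer_category y z"
  proof (rule link_inject)
    have abc: "a \<in> brauer w x" "b \<in> brauer x y" "c \<in> brauer y z"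
      using that by simp_all
    note ab = brauer_mult_closed[OF abc(1,2)] and bc = brauer_mult_closed[OF abc(2,3)]
    show "Comp brauer_category w y z (Comp brauer_category w x y a b) c \<in> brauer w z"
      "Comp brauer_category w x z a (Comp brauer_category x y z b c) \<in> brauer w z"
      using brauer_mult_closed[OF ab abc(3)] brauer_mult_closed[OF abc(1) bc] by simp_all
    show "link (Comp brauer_category w y z (Comp brauer_category w x y a b) c) =
        link (Comp brauer_category w x z a (Comp brauer_category x y z b c))"
      by (simp add: link_mult[OF ab abc(3)] link_mult[OF abc(1) bc] link_mult[OF abc(1,2)]
          link_mult[OF abc(2,3)] O_assoc)
  qed
  show "Star brauer_category a \<in> Hom brauer_category y x" if "a \<in> Hom brauer_category x y"
    using that by (simp add: brauer_rename)
  show "Star brauer_category (Star brauer_category a) = a"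
  proof -
    have "swap_vertex (swap_vertex v) = v" for v
      by (cases v) simp_all
    then show ?thesis
      by (simp add: image_image)
  qed
qed

section \<open>Indicator matrices of relations\<close>

definition rel_mat ::
    "nat \<Rightarrow> nat \<Rightarrow> (nat \<Rightarrow> 'a) \<Rightarrow> (nat \<Rightarrow> 'b) \<Rightarrow> ('a \<times> 'b) set \<Rightarrow> 'k :: semiring_1 mat" where
  "rel_mat M N f g r = mat M N (\<lambda>(i, j). if (f i, g j) \<in> r then 1 else 0)"

lemma sum_indicator_idempotent:
  assumes "(1 :: 'k :: semiring_1) + 1 = 1" and "finite A"
  shows "(\<Sum>k\<in>A. if P k then 1 else 0 :: 'k) = (if \<exists>k\<in>A. P k then 1 else 0)"
  using assms(2) by (induction A rule: finite_induct) (auto simp: assms(1) simp del: one_add_one)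

text \<open>The hypothesis on \<open>r\<close> says that no intermediate element of the composite is lost when only the
elements \<open>g 0, \<dots>, g (N - 1)\<close> are used as middle indices.\<close>
lemma rel_mat_mult:
  assumes idem: "(1 :: 'k :: semiring_1) + 1 = 1"
    and mid: "\<And>i. i < M \<Longrightarrow> r `` {f i} \<subseteq> g ` {..<N}"
  shows "rel_mat M N f g r * rel_mat N T g h s = (rel_mat M T f h (r O s) :: 'k mat)"
proof (rule eq_matI)
  fix i j assume "i < dim_row (rel_mat M T f h (r O s) :: 'k mat)"
    "j < dim_col (rel_mat M T f h (r O s) :: 'k mat)"
  then have ij: "i < M" "j < T"
    by (simp_all add: rel_mat_def)
  have "(rel_mat M N f g r * rel_mat N T g h s :: 'k mat) $$ (i, j) =
      (\<Sum>k\<in>{0..<N}. (if (f i, g k) \<in> r then 1 else 0) * (if (g k, h j) \<in> s then 1 else 0))"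
    using ij by (simp add: rel_mat_def scalar_prod_def)
  also have "\<dots> = (\<Sum>k\<in>{0..<N}. if (f i, g k) \<in> r \<and> (g k, h j) \<in> s then 1 else 0)"
    by (rule sum.cong) auto
  also have "\<dots> = (if \<exists>k\<in>{0..<N}. (f i, g k) \<in> r \<and> (g k, h j) \<in> s then 1 else 0)"
    by (rule sum_indicator_idempotent[OF idem]) simp
  also have "(\<exists>k\<in>{0..<N}. (f i, g k) \<in> r \<and> (g k, h j) \<in> s) \<longleftrightarrow> (f i, h j) \<in> r O s"
  proof
    assume "(f i, h j) \<in> r O s"
    then obtain y where "(f i, y) \<in> r" "(y, h j) \<in> s"
      by auto
    moreover from this obtain k where "k < N" "y = g k"
      using mid[OF ij(1)] by auto
    ultimately show "\<exists>k\<in>{0..<N}. (f i, g k) \<in> r \<and> (g k, h j) \<in> s"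
      by auto
  qed auto
  finally show "(rel_mat M N f g r * rel_mat N T g h s :: 'k mat) $$ (i, j) =
      rel_mat M T f h (r O s) $$ (i, j)"
    using ij by (simp add: rel_mat_def)
qed (simp_all add: rel_mat_def)

lemma rel_mat_id:
  assumes "inj_on f {..<M}" and "f ` {..<M} \<subseteq> A"
  shows "rel_mat M M f f (Id_on A) = (1\<^sub>m M :: 'k :: semiring_1 mat)"
proof (rule eq_matI)
  fix i j assume "i < dim_row (1\<^sub>m M :: 'k mat)" "j < dim_col (1\<^sub>m M :: 'k mat)"
  then have ij: "i < M" "j < M"
    by simp_all
  then have "(f i, f j) \<in> Id_on A \<longleftrightarrow> i = j"
    using assms by (auto simp: Id_on_iff inj_on_eq_iff)
  then show "rel_mat M M f f (Id_on A) $$ (i, j) = (1\<^sub>m M :: 'k mat) $$ (i, j)"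
    using ij by (simp add: rel_mat_def)
qed (simp_all add: rel_mat_def)

lemma rel_mat_transpose: "transpose_mat (rel_mat M N f g r) = rel_mat N M g f (r\<inverse>)"
  by (rule eq_matI) (simp_all add: rel_mat_def)

lemma rel_mat_eqD:
  assumes eq: "(rel_mat M N f g r :: 'k :: semiring_1 mat) = rel_mat M N f g s"
    and "x \<in> f ` {..<M}" and "y \<in> g ` {..<N}"
  shows "(x, y) \<in> r \<longleftrightarrow> (x, y) \<in> s"
proof -
  obtain i j where ij: "i < M" "x = f i" "j < N" "y = g j"
    using assms(2,3) by auto
  have "(rel_mat M N f g r :: 'k mat) $$ (i, j) = rel_mat M N f g s $$ (i, j)"
    using eq by simp
  then show ?thesis
    using ij by (simp add: rel_mat_def split: if_splits)
qed

section \<open>Enumerating the subsets of one parity\<close>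

lemma bij_betw_pick: "bij_betw (pick S) {..<card {i. i < N \<and> i \<in> S}} {i. i < N \<and> i \<in> S}"
proof (rule bij_betw_imageI)
  let ?T = "{i. i < N \<and> i \<in> S}"
  have fin: "finite ?T"
    by simp
  have bound: "k < card S \<or> infinite S" if "k < card ?T" for k
  proof (cases "finite S")
    case True
    then have "card ?T \<le> card S"
      by (intro card_mono) auto
    then show ?thesis
      using that by simp
  qed simp
  show "inj_on (pick S) {..<card ?T}"
  proof (rule inj_onI)
    fix k l assume kl: "k \<in> {..<card ?T}" "l \<in> {..<card ?T}" "pick S k = pick S l"
    have "k = card {a \<in> S. a < pick S k}"
      using kl(1) by (intro card_pick[symmetric] bound) simp
    also have "\<dots> = l"
      unfolding kl(3) using kl(2) by (intro card_pick bound) simp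
    finally show "k = l" .
  qed
  show "pick S ` {..<card ?T} = ?T"
  proof
    show "pick S ` {..<card ?T} \<subseteq> ?T"
    proof
      fix i assume "i \<in> pick S ` {..<card ?T}"
      then obtain k where k: "k < card ?T" "i = pick S k"
        by auto
      have "pick S k < N"
        by (rule pick_le[OF k(1)])
      moreover have "pick S k \<in> S"
        by (rule pick_in_set[OF bound[OF k(1)]])
      ultimately show "i \<in> ?T"
        using k(2) by simp
    qed
    show "?T \<subseteq> pick S ` {..<card ?T}"
    proof
      fix i assume i: "i \<in> ?T"
      then have "{a \<in> S. a < i} \<subset> ?T"
        by auto
      then have "card {a \<in> S. a < i} < card ?T"
        by (intro psubset_card_mono fin)
      moreover have "i = pick S (card {a \<in> S. a < i})"
        using i by (simp add: pick_card_in_set)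
      ultimately show "i \<in> pick S ` {..<card ?T}"
        by (intro image_eqI) simp_all
    qed
  qed
qed

definition parity_subsets :: "bool \<Rightarrow> nat \<Rightarrow> nat set set" where
  "parity_subsets p n = {X \<in> Pow {1..n}. odd (card X) = p}"

text \<open>For odd \<open>n\<close> complementation exchanges odd and even subsets, so each kind makes up one half.\<close>
lemma card_parity_subsets:
  assumes "odd n"
  shows "card (parity_subsets p n) = 2 ^ (n - 1)"
proof -
  have compl: "{1..n} - X \<in> parity_subsets (\<not> q) n" if "X \<in> parity_subsets q n" for X q
    using that odd_card_complement[OF assms, of X] by (auto simp: parity_subsets_def)
  have "bij_betw (\<lambda>X. {1..n} - X) (parity_subsets p n) (parity_subsets (\<not> p) n)"
    by (rule bij_betw_byWitness[where f' = "\<lambda>X. {1..n} - X"])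
      (use compl[of _ p] compl[of _ "\<not> p"] in \<open>auto simp: parity_subsets_def double_diff\<close>)
  then have eq: "card (parity_subsets p n) = card (parity_subsets (\<not> p) n)"
    by (rule bij_betw_same_card)
  have "Pow {1..n} = parity_subsets p n \<union> parity_subsets (\<not> p) n"
    unfolding parity_subsets_def by auto
  moreover have "parity_subsets p n \<inter> parity_subsets (\<not> p) n = {}"
    unfolding parity_subsets_def by auto
  moreover have "finite (parity_subsets q n)" for q
    unfolding parity_subsets_def by simp
  ultimately have "card (Pow {1..n}) = card (parity_subsets p n) + card (parity_subsets (\<not> p) n)"
    by (simp add: card_Un_disjoint)
  then have "2 * card (parity_subsets p n) = 2 ^ n"
    using eq by (simp add: card_Pow)
  moreover have "(2 :: nat) ^ n = 2 * 2 ^ (n - 1)"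
    using assms by (cases n) auto
  ultimately show ?thesis
    by simp
qed

text \<open>The index set is not cut off at \<open>2 ^ n\<close> because the submatrices \<open>bar0\<close> and \<open>bar1\<close> are taken with such
an unbounded index set; indices of rows or columns that do not exist are ignored by \<open>submatrix\<close>.\<close>
definition parity_rows :: "(nat \<Rightarrow> nat \<Rightarrow> nat set) \<Rightarrow> bool \<Rightarrow> nat \<Rightarrow> nat set" where
  "parity_rows e p n = {i. odd (card (e n i)) = p}"

definition parity_enum :: "(nat \<Rightarrow> nat \<Rightarrow> nat set) \<Rightarrow> bool \<Rightarrow> nat \<Rightarrow> nat \<Rightarrow> nat set" where
  "parity_enum e p n = e n \<circ> pick (parity_rows e p n)"

text \<open>Both matrices at once, so that one argument serves odd and even subsets.\<close>
definition parity_bar ::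
    "(nat \<Rightarrow> nat \<Rightarrow> nat set) \<Rightarrow> bool \<Rightarrow> nat \<Rightarrow> nat \<Rightarrow> vertex set set \<Rightarrow> 'k :: semiring_1 mat" where
  "parity_bar e p m n a = submatrix (bar e m n a) (parity_rows e p m) (parity_rows e p n)"

lemma bar_parity: "bar1 e = parity_bar e True" "bar0 e = parity_bar e False"
  by (simp_all add: fun_eq_iff bar1_def bar0_def parity_bar_def parity_rows_def)

lemma bij_betw_parity_rows:
  assumes "subset_enumeration e"
  shows "bij_betw (e n) {i. i < 2 ^ n \<and> i \<in> parity_rows e p n} (parity_subsets p n)"
proof (rule bij_betw_subset)
  show e: "bij_betw (e n) {..<2 ^ n} (Pow {1..n})"
    using assms by (simp add: subset_enumeration_def)
  have "e n ` {i. i < 2 ^ n \<and> i \<in> parity_rows e p n} = {X \<in> e n ` {..<2 ^ n}. odd (card X) = p}"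
    by (auto simp: parity_rows_def)
  then show "e n ` {i. i < 2 ^ n \<and> i \<in> parity_rows e p n} = parity_subsets p n"
    unfolding bij_betw_imp_surj_on[OF e] parity_subsets_def .
qed auto

lemma card_parity_rows:
  assumes "subset_enumeration e" and "odd n"
  shows "card {i. i < 2 ^ n \<and> i \<in> parity_rows e p n} = 2 ^ (n - 1)"
  using bij_betw_same_card[OF bij_betw_parity_rows[OF assms(1)]] card_parity_subsets[OF assms(2)]
  by simp

lemma bij_betw_parity_enum:
  assumes "subset_enumeration e" and "odd n"
  shows "bij_betw (parity_enum e p n) {..<2 ^ (n - 1)} (parity_subsets p n)"
  unfolding parity_enum_def
  using bij_betw_trans[OF bij_betw_pick bij_betw_parity_rows[OF assms(1)], of n p]
  unfolding card_parity_rows[OF assms] .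

lemma parity_bar_rel_mat:
  assumes "subset_enumeration e" and "odd m" and "odd n"
  shows "parity_bar e p m n a =
    rel_mat (2 ^ (m - 1)) (2 ^ (n - 1)) (parity_enum e p m) (parity_enum e p n) (link a)"
proof -
  have pick: "pick (parity_rows e p k) i < 2 ^ k" if "odd k" "i < 2 ^ (k - 1)" for k i
    using bij_betw_apply[OF bij_betw_pick, of i "2 ^ k" "parity_rows e p k"] that
    by (simp add: card_parity_rows[OF assms(1)])
  have dim: "dim_row (bar e m n a) = 2 ^ m" "dim_col (bar e m n a) = 2 ^ n"
    by (simp_all add: bar_def)
  show ?thesis
    unfolding parity_bar_def submatrix_def dim card_parity_rows[OF assms(1,2)]
      card_parity_rows[OF assms(1,3)] rel_mat_def
    by (rule eq_matI)
      (simp_all add: bar_def pick assms(2,3) parity_enum_def link_def saturated_def)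
qed

section \<open>The representations\<close>

lemma inv_category_mat: "inv_category (mat_category :: (nat, 'k :: semiring_1 mat) inv_category)"
  by unfold_locales (auto simp: mat_category_def assoc_mult_mat)

lemma inv_category_full_subcategory:
  assumes "inv_category C"
  shows "inv_category (full_subcategory C S)"
proof -
  interpret inv_category C by (rule assms)
  show ?thesis
    by unfold_locales
      (auto simp: full_subcategory_def Ident_closed Comp_closed Comp_Ident_left Comp_Ident_right
        Comp_assoc Star_closed Star_Star)
qed

lemma monoid_End:
  assumes "inv_category C" and "x \<in> Ob C"
  shows "monoid (End_monoid C x)"
proof -
  interpret inv_category C by (rule assms(1))
  show ?thesis
    by (rule monoidI) (use assms(2) in \<open>auto simp: End_monoid_def Ident_closed Comp_closed
      Comp_Ident_left Comp_Ident_right Comp_assoc\<close>)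
qed

lemma faithful_inv_monoid_rep_End:
  assumes "faithful_inv_functor C D Fo Fm" and x: "x \<in> Ob C"
  shows "faithful_inv_monoid_rep (End_monoid C x) (Star C) (End_monoid D (Fo x)) (Star D) (Fm x x)"
proof -
  interpret faithful_inv_functor C D Fo Fm by (rule assms(1))
  interpret source: monoid "End_monoid C x"
    by (rule monoid_End[OF source.inv_category_axioms x])
  interpret target: monoid "End_monoid D (Fo x)"
    by (rule monoid_End[OF target.inv_category_axioms Fo_closed[OF x]])
  show ?thesis
  proof
    show "Fm x x \<in> hom (End_monoid C x) (End_monoid D (Fo x))"
      by (rule homI) (use x in \<open>auto simp: End_monoid_def Fm_closed Fm_Comp\<close>)
    show "Fm x x \<one>\<^bsub>End_monoid C x\<^esub> = \<one>\<^bsub>End_monoid D (Fo x)\<^esub>"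
      using x by (simp add: End_monoid_def Fm_Ident)
    show "Fm x x (Star C a) = Star D (Fm x x a)" if "a \<in> carrier (End_monoid C x)" for a
      using x that by (simp add: End_monoid_def Fm_Star)
    show "inj_on (Fm x x) (carrier (End_monoid C x))"
    proof (rule inj_onI)
      fix a b
      assume "a \<in> carrier (End_monoid C x)" "b \<in> carrier (End_monoid C x)" "Fm x x a = Fm x x b"
      then have "(x, x, a) = (x, x, b)"
        using x by (intro inj_onD[OF inj_on_arrows]) (simp_all add: arrows_def End_monoid_def)
      then show "a = b"
        by simp
    qed
  qed
qed

text \<open>The functor laws are those of \<open>link\<close> transported by \<open>rel_mat\<close>. Equal matrices have equal sizes, which
recovers the objects, and equal supports, which by \<open>link_inject_parity\<close> recovers the diagram.\<close>
lemma faithful_parity_bar: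
  assumes idem: "(1 :: 'k :: semiring_1) + 1 = 1" and e: "subset_enumeration e"
  shows "faithful_inv_functor brauer_odd (mat_category :: (nat, 'k mat) inv_category)
    (\<lambda>n. 2 ^ (n - 1)) (parity_bar e p)"
proof -
  interpret source: inv_category brauer_odd
    unfolding brauer_odd_def by (rule inv_category_full_subcategory[OF inv_category_brauer])
  interpret target: inv_category "mat_category :: (nat, 'k mat) inv_category"
    by (rule inv_category_mat)
  let ?M = "mat_category :: (nat, 'k mat) inv_category"
  have Ob: "x \<in> Ob brauer_odd \<longleftrightarrow> odd x" for x
    by (simp add: brauer_odd_def full_subcategory_def brauer_category_def)
  have src: "Hom brauer_odd = brauer" "Ident brauer_odd = (\<lambda>n. (\<lambda>i. {Upper i, Lower i}) ` {1..n})"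
    "Comp brauer_odd = brauer_mult" "Star brauer_odd = (\<lambda>a. (`) swap_vertex ` a)"
    by (simp_all add: brauer_odd_def full_subcategory_def brauer_category_def)
  have tgt: "Ob ?M = UNIV" "Hom ?M = carrier_mat" "Ident ?M = 1\<^sub>m"
    "Comp ?M = (\<lambda>_ _ _ A B. A * B)" "Star ?M = transpose_mat"
    by (simp_all add: mat_category_def)
  note bar = parity_bar_rel_mat[OF e]
  note enum = bij_betw_parity_enum[OF e]
  show ?thesis
  proof
    fix x y z a b
    show "2 ^ (x - 1) \<in> Ob ?M"
      by (simp add: tgt)
    show "parity_bar e p x y a \<in> Hom ?M (2 ^ (x - 1)) (2 ^ (y - 1))"
      if "x \<in> Ob brauer_odd" "y \<in> Ob brauer_odd"
      using that unfolding Ob tgt by (simp add: bar rel_mat_def)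
    show "parity_bar e p x x (Ident brauer_odd x) = Ident ?M (2 ^ (x - 1))"
      if "x \<in> Ob brauer_odd"
    proof -
      have "odd x"
        using that by (simp add: Ob)
      have "parity_subsets p x \<subseteq> Pow {1..x}"
        by (auto simp: parity_subsets_def)
      then show ?thesis
        using enum[OF \<open>odd x\<close>, of p] unfolding src tgt bar[OF \<open>odd x\<close> \<open>odd x\<close>] link_id
        by (intro rel_mat_id) (simp_all add: bij_betw_def)
    qed
    show "parity_bar e p x z (Comp brauer_odd x y z a b) =
        Comp ?M (2 ^ (x - 1)) (2 ^ (y - 1)) (2 ^ (z - 1)) (parity_bar e p x y a) (parity_bar e p y z b)"
      if "x \<in> Ob brauer_odd" "y \<in> Ob brauer_odd" "z \<in> Ob brauer_odd"
        "a \<in> Hom brauer_odd x y" "b \<in> Hom brauer_odd y z"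
    proof -
      have odd: "odd x" "odd y" "odd z" and a: "a \<in> brauer x y" and b: "b \<in> brauer y z"
        using that by (simp_all add: Ob src)
      \<comment> \<open>Summing over subsets of parity \<open>p\<close> only is enough: \<open>link a\<close> preserves parity.\<close>
      have "link a `` {parity_enum e p x i} \<subseteq> parity_enum e p y ` {..<2 ^ (y - 1)}"
        if "i < 2 ^ (x - 1)" for i
      proof
        fix Y assume "Y \<in> link a `` {parity_enum e p x i}"
        then have Y: "(parity_enum e p x i, Y) \<in> link a"
          by simp
        have "parity_enum e p x i \<in> parity_subsets p x"
          using bij_betw_apply[OF enum[OF odd(1)]] that by simp
        then have "Y \<in> parity_subsets p y"
          using link_bounds(2)[OF a Y] link_parity[OF a Y] by (simp add: parity_subsets_def)
        then show "Y \<in> parity_enum e p y ` {..<2 ^ (y - 1)}"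
          using bij_betw_imp_surj_on[OF enum[OF odd(2)]] by simp
      qed
      from rel_mat_mult[OF idem this] show ?thesis
        unfolding src tgt bar[OF odd(1,2)] bar[OF odd(2,3)] bar[OF odd(1,3)] link_mult[OF a b]
        by (rule sym)
    qed
    show "parity_bar e p y x (Star brauer_odd a) = Star ?M (parity_bar e p x y a)"
      if "x \<in> Ob brauer_odd" "y \<in> Ob brauer_odd" "a \<in> Hom brauer_odd x y"
    proof -
      have odd: "odd x" "odd y" and a: "a \<in> brauer x y"
        using that by (simp_all add: Ob src)
      show ?thesis
        unfolding src tgt bar[OF odd] bar[OF odd(2,1)] rel_mat_transpose link_swap[OF a] ..
    qed
  next
    have inj: "x = y" if "odd x" "odd y" "(2 :: nat) ^ (x - 1) = 2 ^ (y - 1)" for x y :: nat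
      using that by (cases x; cases y) auto
    then show "inj_on (\<lambda>n. 2 ^ (n - 1) :: nat) (Ob brauer_odd)"
      by (intro inj_onI) (simp add: Ob)
    show "inj_on (\<lambda>(x, y, a). parity_bar e p x y a :: 'k mat) (arrows brauer_odd)"
    proof (rule inj_onI, clarsimp)
      fix x y a x' y' b
      assume "(x, y, a) \<in> arrows brauer_odd" "(x', y', b) \<in> arrows brauer_odd"
        and eq: "(parity_bar e p x y a :: 'k mat) = parity_bar e p x' y' b"
      then have odd: "odd x" "odd y" "odd x'" "odd y'"
        and a: "a \<in> brauer x y" and b: "b \<in> brauer x' y'"
        by (simp_all add: arrows_def Ob src)
      have "(2 :: nat) ^ (x - 1) = 2 ^ (x' - 1)" "(2 :: nat) ^ (y - 1) = 2 ^ (y' - 1)"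
        using arg_cong[OF eq, of dim_row] arg_cong[OF eq, of dim_col]
        unfolding bar[OF odd(1,2)] bar[OF odd(3,4)] by (simp_all add: rel_mat_def)
      then have xy: "x' = x" "y' = y"
        using inj odd by auto
      have "a = b"
      proof (rule link_inject_parity[OF a b[unfolded xy] odd(1), of p])
        fix X Y :: "nat set" assume X: "odd (card X) = p"
        have iff: "(X, Y) \<in> link a \<longleftrightarrow> (X, Y) \<in> link b"
          if "X \<in> parity_subsets p x" "Y \<in> parity_subsets p y"
          using eq that enum[OF odd(1), of p] enum[OF odd(2), of p]
          unfolding xy bar[OF odd(1,2)] by (intro rel_mat_eqD[where 'k = 'k]) (auto simp: bij_betw_def)
        have mem: "X \<in> parity_subsets p x \<and> Y \<in> parity_subsets p y"
          if "c \<in> brauer x y" "(X, Y) \<in> link c" for c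
          using link_bounds[OF that] link_parity[OF that] X by (simp add: parity_subsets_def)
        show "(X, Y) \<in> link a \<longleftrightarrow> (X, Y) \<in> link b"
          using iff mem[OF a] mem[OF b[unfolded xy]] by blast
      qed
      then show "x = x' \<and> y = y' \<and> a = b"
        using xy by simp
    qed
  qed
qed

theorem theorem5p2:
  fixes e :: "nat \<Rightarrow> nat \<Rightarrow> nat set"
  assumes "(1 :: 'k :: semiring_1) + 1 = 1"
    and "subset_enumeration e"
  shows
    "faithful_inv_functor brauer_odd (mat_category :: (nat, 'k mat) inv_category)
        (\<lambda>n. 2 ^ (n - 1)) (bar1 e)
     \<and> faithful_inv_functor brauer_odd (mat_category :: (nat, 'k mat) inv_category)
        (\<lambda>n. 2 ^ (n - 1)) (bar0 e)
     \<and> (\<forall>n. odd n \<longrightarrow>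
          faithful_inv_monoid_rep
            (End_monoid brauer_category n) (Star brauer_category)
            (End_monoid (mat_category :: (nat, 'k mat) inv_category) (2 ^ (n - 1)))
            (Star (mat_category :: (nat, 'k mat) inv_category))
            (bar1 e n n)
          \<and> faithful_inv_monoid_rep
            (End_monoid brauer_category n) (Star brauer_category)
            (End_monoid (mat_category :: (nat, 'k mat) inv_category) (2 ^ (n - 1)))
            (Star (mat_category :: (nat, 'k mat) inv_category))
            (bar0 e n n))"
proof -
  have rep: "faithful_inv_functor brauer_odd (mat_category :: (nat, 'k mat) inv_category)
      (\<lambda>n. 2 ^ (n - 1)) (parity_bar e p)" for p
    by (rule faithful_parity_bar[OF assms])
  have "End_monoid brauer_odd n = End_monoid brauer_category n"
    "Star brauer_odd = Star brauer_category"
    "odd n \<Longrightarrow> n \<in> Ob brauer_odd" for n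
    by (simp_all add: End_monoid_def brauer_odd_def full_subcategory_def brauer_category_def)
  then have "faithful_inv_monoid_rep (End_monoid brauer_category n) (Star brauer_category)
      (End_monoid (mat_category :: (nat, 'k mat) inv_category) (2 ^ (n - 1)))
      (Star (mat_category :: (nat, 'k mat) inv_category)) (parity_bar e p n n)"
    if "odd n" for n p
    using faithful_inv_monoid_rep_End[OF rep, of n p] that by simp
  then show ?thesis
    unfolding bar_parity using rep by blast
qed

end
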